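(* For every positive integer $n$, $|B_n(132,213,312)|=|B_n(213,231,312)|$.
   Context: A permutation $\sigma\in S_n$ is written as $\sigma(1)\cdots\sigma(n)$. An index $i\in[n-1]$ is an ascent if $\sigma(i)<\sigma(i+1)$ and a descent if $\sigma(i)>\sigma(i+1)$. A ballot permutation is a permutation such that every prefix $\sigma(1)\cdots\sigma(p)$ has at least as many ascents as descents. $\sigma$ contains a pattern $\pi\in S_k$ if some subsequence $\sigma(c_1)\cdots\sigma(c_k)$ with $c_1<\dots<c_k$ is order-isomorphic to $\pi$, and avoids $\pi$ otherwise. $B_n(\pi_1,\dots,\pi_m)$ denotes the set of ballot permutations of length $n$ avoiding all of $\pi_1,\dots,\pi_m$. *)

theory Defs
  imports "HOL-Combinatorics.Multiset_Permutations" "HOL-Library.Sublist"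
begin

text \<open>
  A permutation in \<open>S\<^sub>n\<close> is represented by its one-line word \<open>\<sigma>(1) \<dots> \<sigma>(n)\<close>, that is, by an
  element of \<^term>\<open>permutations_of_set {1..n}\<close>. List positions start at 0, so \<open>\<sigma>(i)\<close> is
  \<^term>\<open>\<sigma> ! (i - 1)\<close>; ascents and descents are indexed by \<open>1, \<dots>, n - 1\<close> as usual.
\<close>

definition ascents :: "nat list \<Rightarrow> nat set" where
  "ascents w = {i \<in> {1..<length w}. w ! (i - 1) < w ! i}"

definition descents :: "nat list \<Rightarrow> nat set" where
  "descents w = {i \<in> {1..<length w}. w ! (i - 1) > w ! i}"

definition ballot :: "nat list \<Rightarrow> bool" where
  "ballot \<sigma> \<longleftrightarrow> (\<forall>\<tau>. prefix \<tau> \<sigma> \<longrightarrow> card (descents \<tau>) \<le> card (ascents \<tau>))"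

definition order_isomorphic :: "nat list \<Rightarrow> nat list \<Rightarrow> bool" where
  "order_isomorphic u v \<longleftrightarrow>
     length u = length v \<and>
     (\<forall>i < length u. \<forall>j < length u. u ! i < u ! j \<longleftrightarrow> v ! i < v ! j)"

text \<open>\<^term>\<open>subseq\<close> is the library's notion of a not necessarily contiguous subsequence.\<close>

definition contains_pattern :: "nat list \<Rightarrow> nat list \<Rightarrow> bool" where
  "contains_pattern \<sigma> \<pi> \<longleftrightarrow> (\<exists>\<tau>. subseq \<tau> \<sigma> \<and> order_isomorphic \<tau> \<pi>)"

definition avoids_pattern :: "nat list \<Rightarrow> nat list \<Rightarrow> bool" where
  "avoids_pattern \<sigma> \<pi> \<longleftrightarrow> \<not> contains_pattern \<sigma> \<pi>"

definition ballot_avoiders :: "nat \<Rightarrow> nat list set \<Rightarrow> nat list set" where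
  "ballot_avoiders n P =
     {\<sigma> \<in> permutations_of_set {1..n}. ballot \<sigma> \<and> (\<forall>\<pi>\<in>P. avoids_pattern \<sigma> \<pi>)}"

lemma finite_ballot_avoiders: "finite (ballot_avoiders n P)"
  by (simp add: ballot_avoiders_def)

end

theory Submission
  imports Defs
begin

text \<open>
  Avoiding 213 and 312 forces a word to increase up to its maximum and to decrease afterwards.
  Avoiding 132 then means that every entry after the maximum is smaller than every entry before it,
  while avoiding 231 means the opposite; in either case the permutation is determined by the
  number \<open>k\<close> of entries after the maximum. The two permutations belonging to the same \<open>k\<close> have the
  same ascents and descents, so one is ballot iff the other is.
\<close>

section \<open>Length-three patterns as inequalities between entries\<close>

lemma contains_pattern_length3_iff:
  "contains_pattern \<sigma> [a, b, c] \<longleftrightarrow>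
     (\<exists>x y z. subseq [x, y, z] \<sigma> \<and> order_isomorphic [x, y, z] [a, b, c])"
proof
  assume "contains_pattern \<sigma> [a, b, c]"
  then obtain \<tau> where \<tau>: "subseq \<tau> \<sigma>" "order_isomorphic \<tau> [a, b, c]"
    unfolding contains_pattern_def by blast
  then have "length \<tau> = Suc (Suc (Suc 0))"
    by (simp add: order_isomorphic_def)
  then obtain x y z where "\<tau> = [x, y, z]"
    by (auto simp: length_Suc_conv)
  with \<tau> show "\<exists>x y z. subseq [x, y, z] \<sigma> \<and> order_isomorphic [x, y, z] [a, b, c]"
    by blast
qed (auto simp: contains_pattern_def)

lemma order_isomorphic_length3_iff:
  "order_isomorphic [x, y, z] [1, 3, 2] \<longleftrightarrow> x < z \<and> z < y"
  "order_isomorphic [x, y, z] [2, 1, 3] \<longleftrightarrow> y < x \<and> x < z"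
  "order_isomorphic [x, y, z] [2, 3, 1] \<longleftrightarrow> z < x \<and> x < y"
  "order_isomorphic [x, y, z] [3, 1, 2] \<longleftrightarrow> y < z \<and> z < x"
  unfolding order_isomorphic_def by (auto simp: All_less_Suc)

lemma avoids_pattern_length3_iff:
  "avoids_pattern \<sigma> [1, 3, 2] \<longleftrightarrow> (\<forall>x y z. subseq [x, y, z] \<sigma> \<longrightarrow> \<not> (x < z \<and> z < y))"
  "avoids_pattern \<sigma> [2, 1, 3] \<longleftrightarrow> (\<forall>x y z. subseq [x, y, z] \<sigma> \<longrightarrow> \<not> (y < x \<and> x < z))"
  "avoids_pattern \<sigma> [2, 3, 1] \<longleftrightarrow> (\<forall>x y z. subseq [x, y, z] \<sigma> \<longrightarrow> \<not> (z < x \<and> x < y))"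
  "avoids_pattern \<sigma> [3, 1, 2] \<longleftrightarrow> (\<forall>x y z. subseq [x, y, z] \<sigma> \<longrightarrow> \<not> (y < z \<and> z < x))"
  unfolding avoids_pattern_def contains_pattern_length3_iff order_isomorphic_length3_iff
  by blast+

text \<open>Splitting at one letter after another gives the positions; with them the closed formulas
  for entries apply to subsequences.\<close>

lemma subseq_length3_nth:
  assumes "subseq [x, y, z] w"
  obtains i j l where "i < j" "j < l" "l < length w" "w ! i = x" "w ! j = y" "w ! l = z"
proof -
  obtain us vs where w: "w = us @ x # vs" and yz: "subseq [y, z] vs"
    using list_emb_ConsD[OF assms] by auto
  obtain us' vs' where vs: "vs = us' @ y # vs'" and z: "subseq [z] vs'"
    using list_emb_ConsD[OF yz] by auto
  obtain us'' vs'' where vs': "vs' = us'' @ z # vs''"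
    using list_emb_ConsD[OF z] by auto
  show thesis
  proof (rule that)
    show "length us < length us + 1 + length us'" by simp
    show "length us + 1 + length us' < length us + 1 + length us' + 1 + length us''" by simp
  qed (simp_all add: w vs vs' nth_append)
qed

section \<open>Sortedness and blocks of values\<close>

lemma sorted_wrt_iff_subseq:
  "sorted_wrt R xs \<longleftrightarrow> (\<forall>x y. subseq [x, y] xs \<longrightarrow> R x y)"
proof (induction xs)
  case (Cons a xs)
  have "subseq [x, y] (a # xs) \<longleftrightarrow> subseq [x, y] xs \<or> x = a \<and> y \<in> set xs" for x y
    by (cases "x = a") (auto simp: subseq_singleton_left dest: subseq_Cons' list_emb_set)
  with Cons show ?case by auto
qed simp

text \<open>A pair out of order in \<open>A\<close>, followed by the larger \<open>m\<close>, would
  form 213; a rising pair in \<open>D\<close>, preceded by \<open>m\<close>, would form 312.\<close>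

lemma unimodal_if_avoids:
  assumes "\<forall>x \<in> set A \<union> set D. x < m"
    and "avoids_pattern (A @ m # D) [2, 1, 3]" and "avoids_pattern (A @ m # D) [3, 1, 2]"
  shows "sorted A" and "sorted (rev D)"
proof -
  have "x \<le> y" if "subseq [x, y] A" for x y
  proof -
    have "subseq [x, y, m] (A @ m # D)"
      using list_emb_append_mono[OF that, of "[m]" "m # D"] by simp
    then have "\<not> (y < x \<and> x < m)"
      using assms(2) unfolding avoids_pattern_length3_iff by blast
    moreover have "x \<in> set A"
      using list_emb_set[OF that, of x] by auto
    ultimately show ?thesis
      using assms(1) by auto
  qed
  then show "sorted A"
    by (simp add: sorted_wrt_iff_subseq)
  have "y \<le> x" if "subseq [x, y] D" for x y
  proof -
    have "subseq [m, x, y] (A @ m # D)"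
      using that by (intro list_emb_append2) simp
    then have "\<not> (x < y \<and> y < m)"
      using assms(3) unfolding avoids_pattern_length3_iff by blast
    moreover have "y \<in> set D"
      using list_emb_set[OF that, of y] by auto
    ultimately show ?thesis
      using assms(1) by auto
  qed
  then have "sorted_wrt (\<lambda>x y. y \<le> x) D"
    by (simp add: sorted_wrt_iff_subseq)
  then show "sorted (rev D)"
    by (simp add: sorted_wrt_rev)
qed

text \<open>A value up to \<open>Max L\<close> cannot lie in \<open>U\<close>, whose elements all
  exceed \<open>Max L\<close>, so \<open>L\<close> is an initial segment. This will identify the
  values before and after the maximum of a permutation.\<close>

lemma lower_set_eq_atLeastAtMost:
  fixes L U :: "nat set"
  assumes "L \<union> U = {1..n}" and "\<forall>x\<in>L. \<forall>y\<in>U. x < y"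
  shows "L = {1..card L}" and "U = {Suc (card L)..n}"
proof -
  have fin: "finite L" using assms(1) finite_subset[of L "{1..n}"] by auto
  obtain k where k: "L = {1..k}"
  proof (cases "L = {}")
    case True
    then show thesis using that[of 0] by simp
  next
    case False
    have "L = {1..Max L}"
    proof
      show "L \<subseteq> {1..Max L}" using assms(1) fin by auto
      show "{1..Max L} \<subseteq> L"
      proof
        fix x assume x: "x \<in> {1..Max L}"
        have M: "Max L \<in> L" using fin False by simp
        then have "Max L \<in> {1..n}" using assms(1) by blast
        then have "x \<in> L \<union> U" using x assms(1) by auto
        then show "x \<in> L" using M assms(2) x by force
      qed
    qed
    then show thesis by (rule that)
  qed
  then show L: "L = {1..card L}" by simp
  have "L \<inter> U = {}" using assms(2) by blast
  then have "U = {1..n} - L" using assms(1) by blast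
  also have "\<dots> = {Suc (card L)..n}" by (subst L) auto
  finally show "U = {Suc (card L)..n}" .
qed

section \<open>The two families of unimodal permutations\<close>

definition above_below :: "nat \<Rightarrow> nat \<Rightarrow> nat list" where
  "above_below n k = [Suc k..<Suc n] @ rev [1..<Suc k]"

text \<open>For \<open>k < n\<close>, exactly \<open>k\<close> entries follow the maximum
  \<open>n\<close> in both words. Here \<open>n\<close> heads the decreasing block, which thus has
  \<open>k + 1\<close> entries; in \<open>above_below\<close> it ends the increasing block.\<close>

definition below_above :: "nat \<Rightarrow> nat \<Rightarrow> nat list" where
  "below_above n k = [1..<n - k] @ rev [n - k..<Suc n]"

lemma length_above_below: "k < n \<Longrightarrow> length (above_below n k) = n"
  by (simp add: above_below_def del: upt_Suc)

lemma length_below_above: "k < n \<Longrightarrow> length (below_above n k) = n"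
  by (simp add: below_above_def del: upt_Suc)

lemma nth_above_below:
  "k < n \<Longrightarrow> i < n \<Longrightarrow> above_below n k ! i = (if i < n - k then Suc (k + i) else n - i)"
  unfolding above_below_def by (auto simp: nth_append rev_nth simp del: upt_Suc)

lemma nth_below_above:
  "k < n \<Longrightarrow> i < n \<Longrightarrow>
     below_above n k ! i = (if Suc i < n - k then Suc i else n - Suc i + (n - k))"
  unfolding below_above_def by (auto simp: nth_append rev_nth simp del: upt_Suc)

lemma above_below_permutation:
  "k < n \<Longrightarrow> above_below n k \<in> permutations_of_set {1..n}"
  unfolding above_below_def permutations_of_set_def by auto

lemma below_above_permutation:
  "k < n \<Longrightarrow> below_above n k \<in> permutations_of_set {1..n}"
  unfolding below_above_def permutations_of_set_def by (cases k) (auto simp del: upt_Suc)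

text \<open>An increasing block followed by a decreasing one has no valley, so 213 and 312 cannot
  occur. In a 132 the last entry would lie in the decreasing block, hence be at most
  \<open>k\<close>, and no earlier entry is smaller than it.\<close>

lemma above_below_avoids:
  assumes "k < n" and "\<pi> \<in> {[1, 3, 2], [2, 1, 3], [3, 1, 2]}"
  shows "avoids_pattern (above_below n k) \<pi>"
proof -
  have *: "\<not> (x < z \<and> z < y) \<and> \<not> (y < x \<and> x < z) \<and> \<not> (y < z \<and> z < x)"
    if xyz: "subseq [x, y, z] (above_below n k)" for x y z
  proof -
    obtain i j l where "i < j" "j < l" "l < n" "above_below n k ! i = x"
      "above_below n k ! j = y" "above_below n k ! l = z"
      using subseq_length3_nth[OF xyz] length_above_below[OF assms(1)] by metis
    with assms(1) show ?thesis
      by (auto simp: nth_above_below split: if_splits)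
  qed
  have "avoids_pattern (above_below n k) [1, 3, 2]" "avoids_pattern (above_below n k) [2, 1, 3]"
    "avoids_pattern (above_below n k) [3, 1, 2]"
    unfolding avoids_pattern_length3_iff using * by blast+
  with assms(2) show ?thesis by blast
qed

text \<open>Again there is no valley. In a 231 the first entry would lie in the increasing block,
  below \<open>n - k\<close>, and the last one in the decreasing block, where all entries are at
  least \<open>n - k\<close>.\<close>

lemma below_above_avoids:
  assumes "k < n" and "\<pi> \<in> {[2, 1, 3], [2, 3, 1], [3, 1, 2]}"
  shows "avoids_pattern (below_above n k) \<pi>"
proof -
  have *: "\<not> (z < x \<and> x < y) \<and> \<not> (y < x \<and> x < z) \<and> \<not> (y < z \<and> z < x)"
    if xyz: "subseq [x, y, z] (below_above n k)" for x y z
  proof -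
    obtain i j l where "i < j" "j < l" "l < n" "below_above n k ! i = x"
      "below_above n k ! j = y" "below_above n k ! l = z"
      using subseq_length3_nth[OF xyz] length_below_above[OF assms(1)] by metis
    with assms(1) show ?thesis
      by (auto simp: nth_below_above split: if_splits)
  qed
  have "avoids_pattern (below_above n k) [2, 1, 3]" "avoids_pattern (below_above n k) [2, 3, 1]"
    "avoids_pattern (below_above n k) [3, 1, 2]"
    unfolding avoids_pattern_length3_iff using * by blast+
  with assms(2) show ?thesis by blast
qed

section \<open>Classification of the avoiders\<close>

lemma unimodal_permutation_split:
  assumes "\<sigma> \<in> permutations_of_set {1..n}" and "n \<ge> 1"
    and "avoids_pattern \<sigma> [2, 1, 3]" and "avoids_pattern \<sigma> [3, 1, 2]"
  obtains A D where "\<sigma> = A @ n # D" "set D \<union> set A = {1..n - 1}" "distinct \<sigma>" "length D < n"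
    "sorted A" "sorted (rev D)"
proof -
  have \<sigma>: "set \<sigma> = {1..n}" "distinct \<sigma>"
    using assms(1) by (auto simp: permutations_of_set_def)
  then have len: "length \<sigma> = n"
    using distinct_card by fastforce
  have "n \<in> set \<sigma>" using \<sigma> assms(2) by simp
  then obtain A D where AD: "\<sigma> = A @ n # D"
    by (meson split_list)
  then have "set D \<union> set A = set \<sigma> - {n}"
    using \<sigma>(2) by auto
  also have "\<dots> = {1..n - 1}" unfolding \<sigma>(1) by auto
  finally have sets: "set D \<union> set A = {1..n - 1}" .
  have "x < n" if "x \<in> set A \<union> set D" for x
  proof -
    have "x \<in> {1..n - 1}" using that sets by blast
    with assms(2) show ?thesis by auto
  qed
  then have "sorted A" "sorted (rev D)"
    using unimodal_if_avoids[of A D n] assms(3,4) unfolding AD by blast+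
  with sets \<sigma>(2) len show thesis
    by (intro that[OF AD]) (simp_all add: AD)
qed

lemma sorted_distinct_eq_upt:
  "sorted xs \<Longrightarrow> distinct xs \<Longrightarrow> set xs = {a..<b} \<Longrightarrow> xs = [a..<b]"
  by (simp add: sorted_distinct_set_unique)

lemma avoiders_above_below:
  assumes "n \<ge> 1" and "\<sigma> \<in> permutations_of_set {1..n}"
    and "avoids_pattern \<sigma> [2, 1, 3]" "avoids_pattern \<sigma> [3, 1, 2]" "avoids_pattern \<sigma> [1, 3, 2]"
  shows "\<exists>k<n. \<sigma> = above_below n k"
proof -
  obtain A D where \<sigma>: "\<sigma> = A @ n # D" and AD: "set D \<union> set A = {1..n - 1}"
    and dist: "distinct \<sigma>" and len: "length D < n" and sorted: "sorted A" "sorted (rev D)"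
    using unimodal_permutation_split[OF assms(2,1,3,4)] .
  have sep: "\<forall>d\<in>set D. \<forall>a\<in>set A. d < a"
  proof (intro ballI)
    fix a d assume that: "d \<in> set D" "a \<in> set A"
    \<comment> \<open>With the peak \<open>n\<close> in the middle, \<open>a < d\<close> would make
      this subsequence a 132.\<close>
    have "subseq [a, n, d] (A @ n # D)"
      using list_emb_append_mono[of "(=)" "[a]" A "[n, d]" "n # D"] that
      by (simp add: subseq_singleton_left)
    then have "\<not> (a < d \<and> d < n)"
      using assms(5) unfolding \<sigma> avoids_pattern_length3_iff by blast
    moreover have "a \<noteq> d" using that dist by (auto simp: \<sigma>)
    moreover have "a \<in> {1..n - 1}" "d \<in> {1..n - 1}" using that AD by blast+
    ultimately show "d < a" by auto
  qed
  define k where "k = length D"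
  have less: "k < n" using len by (simp add: k_def)
  have k: "card (set D) = k" using dist by (simp add: \<sigma> distinct_card k_def)
  have "set D = {1..k}" and "set A = {Suc k..n - 1}"
    using lower_set_eq_atLeastAtMost[OF AD sep] unfolding k .
  then have "set A = {Suc k..<n}" and "set (rev D) = {1..<Suc k}"
    using assms(1) by auto
  \<comment> \<open>A sorted list without repetitions is determined by its set.\<close>
  then have "A = [Suc k..<n]" and "rev D = [1..<Suc k]"
    using sorted dist unfolding \<sigma> by (simp_all add: sorted_distinct_eq_upt del: upt_Suc)
  moreover from this(2) have "D = rev [1..<Suc k]" by (metis rev_rev_ident)
  \<comment> \<open>The peak joins the increasing block: \<open>[Suc k..<n] @ [n]\<close> is
    \<open>[Suc k..<Suc n]\<close> because \<open>k < n\<close>.\<close>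
  ultimately have "\<sigma> = above_below n k"
    using less by (simp add: \<sigma> above_below_def)
  with less show ?thesis by blast
qed

lemma avoiders_below_above:
  assumes "n \<ge> 1" and "\<sigma> \<in> permutations_of_set {1..n}"
    and "avoids_pattern \<sigma> [2, 1, 3]" "avoids_pattern \<sigma> [3, 1, 2]" "avoids_pattern \<sigma> [2, 3, 1]"
  shows "\<exists>k<n. \<sigma> = below_above n k"
proof -
  obtain A D where \<sigma>: "\<sigma> = A @ n # D" and AD: "set D \<union> set A = {1..n - 1}"
    and dist: "distinct \<sigma>" and len: "length D < n" and sorted: "sorted A" "sorted (rev D)"
    using unimodal_permutation_split[OF assms(2,1,3,4)] .
  have sep: "\<forall>a\<in>set A. \<forall>d\<in>set D. a < d"
  proof (intro ballI)
    fix a d assume that: "d \<in> set D" "a \<in> set A"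
    \<comment> \<open>Now \<open>d < a\<close> is what is excluded, since it would give a
      231.\<close>
    have "subseq [a, n, d] (A @ n # D)"
      using list_emb_append_mono[of "(=)" "[a]" A "[n, d]" "n # D"] that
      by (simp add: subseq_singleton_left)
    then have "\<not> (d < a \<and> a < n)"
      using assms(5) unfolding \<sigma> avoids_pattern_length3_iff by blast
    moreover have "a \<noteq> d" using that dist by (auto simp: \<sigma>)
    moreover have "a \<in> {1..n - 1}" "d \<in> {1..n - 1}" using that AD by blast+
    ultimately show "a < d" by auto
  qed
  define k where "k = length D"
  have less: "k < n" using len by (simp add: k_def)
  \<comment> \<open>This time \<open>A\<close> holds the small values, so its size is needed: of the
    \<open>n - 1\<close> entries other than the peak, \<open>k\<close> lie in
    \<open>D\<close>.\<close>
  have "card (set D \<union> set A) = card (set D) + card (set A)"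
    using dist by (intro card_Un_disjoint) (auto simp: \<sigma>)
  then have k: "card (set A) = n - Suc k"
    using dist by (simp add: \<sigma> AD distinct_card k_def)
  have "set A = {1..n - Suc k}" and "set D = {Suc (n - Suc k)..n - 1}"
    using lower_set_eq_atLeastAtMost[OF AD[unfolded Un_commute[of "set D"]] sep] unfolding k .
  then have "set A = {1..<n - k}" and "set (rev D) = {n - k..<n}"
    using less by auto
  then have "A = [1..<n - k]" and "rev D = [n - k..<n]"
    using sorted dist unfolding \<sigma> by (simp_all add: sorted_distinct_eq_upt del: upt_Suc)
  moreover from this(2) have "D = rev [n - k..<n]" by (metis rev_rev_ident)
  \<comment> \<open>Here the peak joins the decreasing block: \<open>n # rev [n - k..<n]\<close> is
    \<open>rev [n - k..<Suc n]\<close>.\<close>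
  ultimately have "\<sigma> = below_above n k"
    using less by (simp add: \<sigma> below_above_def)
  with less show ?thesis by blast
qed

section \<open>Transfer of the ballot condition and counting\<close>

lemma ballot_cong:
  assumes len: "length u = length v"
    and asc: "\<And>i. 1 \<le> i \<Longrightarrow> i < length u \<Longrightarrow> u ! (i - 1) < u ! i \<longleftrightarrow> v ! (i - 1) < v ! i"
    and desc: "\<And>i. 1 \<le> i \<Longrightarrow> i < length u \<Longrightarrow> u ! (i - 1) > u ! i \<longleftrightarrow> v ! (i - 1) > v ! i"
  shows "ballot u \<longleftrightarrow> ballot v"
proof -
  \<comment> \<open>Indexing prefixes by their length allows prefixes of \<open>u\<close> and
    \<open>v\<close> to be compared one by one.\<close>
  have ballot_take: "ballot w \<longleftrightarrow> (\<forall>p. card (descents (take p w)) \<le> card (ascents (take p w)))"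
    for w
    unfolding ballot_def by (metis append_eq_conv_conj prefix_def take_is_prefix)
  have "ascents (take p u) = ascents (take p v)" "descents (take p u) = descents (take p v)" for p
    unfolding ascents_def descents_def using len asc desc by auto
  then show ?thesis by (simp add: ballot_take)
qed

text \<open>Both words rise at the indices before \<open>n - k\<close>, the position of the maximum
  counted from 1, and fall at the remaining \<open>k\<close> indices.\<close>

lemma ballot_above_below_iff:
  "k < n \<Longrightarrow> ballot (above_below n k) \<longleftrightarrow> ballot (below_above n k)"
  by (rule ballot_cong)
    (auto simp: length_above_below length_below_above nth_above_below nth_below_above)

lemma inj_on_above_below: "inj_on (above_below n) {..<n}"
proof (rule inj_onI)
  fix k l assume kl: "k \<in> {..<n}" "l \<in> {..<n}" and eq: "above_below n k = above_below n l"
  \<comment> \<open>The first entry \<open>k + 1\<close> reveals \<open>k\<close>.\<close>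
  then have "above_below n k ! 0 = above_below n l ! 0" by simp
  with kl show "k = l" by (simp add: nth_above_below)
qed

lemma inj_on_below_above: "inj_on (below_above n) {..<n}"
proof (rule inj_onI)
  fix k l assume kl: "k \<in> {..<n}" "l \<in> {..<n}" and eq: "below_above n k = below_above n l"
  \<comment> \<open>The first entry is 1 for every \<open>k < n - 1\<close>, so the last entry
    \<open>n - k\<close> is used instead.\<close>
  then have "below_above n k ! (n - 1) = below_above n l ! (n - 1)" by simp
  with kl show "k = l" by (auto simp: nth_below_above split: if_splits)
qed

theorem theorem4p3:
  fixes n :: nat
  assumes "n \<ge> 1"
  shows "card (ballot_avoiders n {[1, 3, 2], [2, 1, 3], [3, 1, 2]}) =
         card (ballot_avoiders n {[2, 1, 3], [2, 3, 1], [3, 1, 2]})"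
proof -
  \<comment> \<open>By \<open>ballot_above_below_iff\<close> this one index set serves both
    families, so both sides become injective images of it.\<close>
  let ?K = "{k. k < n \<and> ballot (above_below n k)}"
  have "ballot_avoiders n {[1, 3, 2], [2, 1, 3], [3, 1, 2]} = above_below n ` ?K" (is "?B = _")
  proof
    show "?B \<subseteq> above_below n ` ?K"
      using avoiders_above_below[OF assms] unfolding ballot_avoiders_def by blast
    show "above_below n ` ?K \<subseteq> ?B"
      using above_below_avoids above_below_permutation unfolding ballot_avoiders_def by blast
  qed
  moreover have "ballot_avoiders n {[2, 1, 3], [2, 3, 1], [3, 1, 2]} = below_above n ` ?K"
    (is "?B = _")
  proof
    show "?B \<subseteq> below_above n ` ?K"
      using avoiders_below_above[OF assms] ballot_above_below_iff
      unfolding ballot_avoiders_def by blast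
    show "below_above n ` ?K \<subseteq> ?B"
      using below_above_avoids below_above_permutation ballot_above_below_iff
      unfolding ballot_avoiders_def by blast
  qed
  moreover have "inj_on (above_below n) ?K" "inj_on (below_above n) ?K"
    using inj_on_above_below inj_on_below_above by (auto intro: inj_on_subset)
  ultimately show ?thesis
    by (simp add: card_image)
qed

end
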